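(* For every integer $n\ge 0$ and all integers $r,k\in\mathbb{Z}$, $$\sum_{m=0}^{n}\binom{n+1}{m}(-1)^{n-m}s_{m}^{(r,k)}=\sum_{l=0}^{n}\sum_{m=0}^{l}(-1)^{l-m}\binom{l}{m}\binom{n+1}{l+1}B_{m}^{(k-1)}\,\mathbb{B}_{n-l}^{(r)}.$$
   Context: For $k\in\mathbb{Z}$, $Li_k(x)=\sum_{n=1}^{\infty}\frac{x^n}{n^k}$ is the polylogarithm, regarded as a formal power series; $\frac{Li_k(1-e^{-t})}{1-e^{-t}}$ is then a formal power series in $t$ over $\mathbb{C}$. For $k\in\mathbb{Z}$, the poly-Bernoulli numbers $B_n^{(k)}$ are defined by $\frac{Li_k(1-e^{-t})}{1-e^{-t}}=\sum_{n\ge0}B_n^{(k)}\frac{t^n}{n!}$. For $r\in\mathbb{Z}$, the Bernoulli numbers of order $r$, $\mathbb{B}_n^{(r)}$, are defined by $\left(\frac{t}{e^t-1}\right)^r=\sum_{n\ge0}\mathbb{B}_n^{(r)}\frac{t^n}{n!}$. (The symbols $B_n^{(k)}$ and $\mathbb{B}_n^{(r)}$ denote different sequences.) For $r,k\in\mathbb{Z}$, the higher-order Bernoulli and poly-Bernoulli mixed type numbers $s_n^{(r,k)}$ are defined by $\left(\frac{t}{e^t-1}\right)^r\frac{Li_k(1-e^{-t})}{1-e^{-t}}=\sum_{n\ge0}s_n^{(r,k)}\frac{t^n}{n!}$. *)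

theory Defs
  imports Complex_Main "HOL-Computational_Algebra.Formal_Power_Series"
begin

definition polylog_fps :: "int \<Rightarrow> complex fps" where
  "polylog_fps k = Abs_fps (\<lambda>n. if n = 0 then 0 else 1 / (of_nat n powi k))"

(* 1 - e^(-t) has zero constant term and nonzero linear term, so both the composition and
   the division (which cancels one factor t) agree with the usual ones. *)
definition poly_bernoulli_fps :: "int \<Rightarrow> complex fps" where
  "poly_bernoulli_fps k =
     (polylog_fps k oo (1 - fps_exp (-1))) / (1 - fps_exp (-1))"

(* t / (e^t - 1) has constant term 1, so it is a unit and negative integer powers are powers
   of its genuine inverse. *)
definition bernoulli_order_fps :: "int \<Rightarrow> complex fps" where
  "bernoulli_order_fps r = (fps_X / (fps_exp 1 - 1)) powi r"

definition poly_bernoulli :: "int \<Rightarrow> nat \<Rightarrow> complex" where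
  "poly_bernoulli k n = fact n * fps_nth (poly_bernoulli_fps k) n"

definition bernoulli_order :: "int \<Rightarrow> nat \<Rightarrow> complex" where
  "bernoulli_order r n = fact n * fps_nth (bernoulli_order_fps r) n"

definition mixed_bernoulli :: "int \<Rightarrow> int \<Rightarrow> nat \<Rightarrow> complex" where
  "mixed_bernoulli r k n =
     fact n * fps_nth (bernoulli_order_fps r * poly_bernoulli_fps k) n"

end

theory Submission
  imports Defs
begin

text \<open>
  Put \<open>u = 1 - exp (-t)\<close> and \<open>L = Li_k(u)\<close>. Multiplying the generating function of the mixed numbers
  by \<open>u\<close> turns it into \<open>(t / (exp t - 1))^r L\<close>, and the left-hand side is its coefficient of index
  \<open>n + 1\<close>. On the other hand \<open>L' = exp (-t) Li_{k-1}(u) / u\<close>, so the inner sums on the right are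
  the coefficients of \<open>L\<close> shifted by one, and the right-hand side is the same Cauchy product.
\<close>

text \<open>Binomial convolution of exponential generating functions: \<open>fps_exp (-1)\<close>
  supplies the signs. Both sides of the theorem reduce to it.\<close>

lemma sum_binomial_fps_exp_minus:
  fixes F :: "complex fps"
  shows "(\<Sum>m=0..n. (-1) ^ (n - m) * of_nat (n choose m) * (fact m * fps_nth F m)) =
         fact n * fps_nth (F * fps_exp (-1)) n"
proof -
  have "(\<Sum>m=0..n. (-1) ^ (n - m) * of_nat (n choose m) * (fact m * fps_nth F m)) =
        (\<Sum>m=0..n. fact n * (fps_nth F m * fps_nth (fps_exp (-1)) (n - m)))"
    by (rule sum.cong) (auto simp: binomial_fact field_simps)
  then show ?thesis
    by (simp add: fps_mult_nth sum_distrib_left)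
qed

text \<open>Differentiation brings down a factor that lowers the exponent by one; the shift is
  division by \<open>fps_X\<close>, exact because the constant term is 0.\<close>

lemma fps_deriv_polylog:
  "fps_deriv (polylog_fps k) = fps_shift 1 (polylog_fps (k - 1))"
proof (rule fps_ext)
  fix n
  have "(of_nat (Suc n) :: complex) \<noteq> 0"
    by (rule of_nat_neq_0)
  then have "of_nat (Suc n) * (1 / of_nat (Suc n) powi k) =
             (1 / of_nat (Suc n) powi (k - 1) :: complex)"
    by (simp add: power_int_diff del: of_nat_Suc)
  then show "fps_nth (fps_deriv (polylog_fps k)) n = fps_nth (fps_shift 1 (polylog_fps (k - 1))) n"
    by (simp add: polylog_fps_def)
qed

lemma polylog_compose_eq:
  assumes "fps_nth u 0 = 0"
  shows "polylog_fps k oo u = (fps_shift 1 (polylog_fps k) oo u) * u"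
proof -
  have "polylog_fps k = fps_shift 1 (polylog_fps k) * fps_X"
    by (rule fps_ext) (auto simp: polylog_fps_def)
  then have "polylog_fps k oo u = (fps_shift 1 (polylog_fps k) * fps_X) oo u"
    by (rule arg_cong)
  then show ?thesis
    using assms by (simp add: fps_compose_mult_distrib)
qed

lemma one_minus_fps_exp_neq_0: "1 - fps_exp (-1 :: complex) \<noteq> 0"
proof
  assume "1 - fps_exp (-1 :: complex) = 0"
  then have "fps_nth (1 - fps_exp (-1 :: complex)) 1 = 0" by simp
  then show False by simp
qed

text \<open>This quotient-free form is what the chain rule produces when
  \<open>polylog_fps (k + 1)\<close> is composed with \<open>1 - fps_exp (-1)\<close>.\<close>

lemma poly_bernoulli_fps_eq:
  "poly_bernoulli_fps k = fps_shift 1 (polylog_fps k) oo (1 - fps_exp (-1))"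
  using one_minus_fps_exp_neq_0
  by (simp add: poly_bernoulli_fps_def polylog_compose_eq)

lemma poly_bernoulli_fps_mult:
  "poly_bernoulli_fps k * (1 - fps_exp (-1)) = polylog_fps k oo (1 - fps_exp (-1))"
  by (simp add: poly_bernoulli_fps_eq polylog_compose_eq)

lemma fps_deriv_polylog_compose:
  "fps_deriv (polylog_fps k oo (1 - fps_exp (-1))) = poly_bernoulli_fps (k - 1) * fps_exp (-1)"
  by (simp add: fps_compose_deriv fps_deriv_polylog poly_bernoulli_fps_eq
      flip: fps_const_neg)

text \<open>The sum is a coefficient of the derivative of the composed polylogarithm; the factor
  \<open>l + 1\<close> from differentiation turns \<open>fact l\<close> into
  \<open>fact (l + 1)\<close>.\<close>

lemma sum_poly_bernoulli:
  "(\<Sum>m=0..l. (-1) ^ (l - m) * of_nat (l choose m) * poly_bernoulli (k - 1) m) =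
   fact (l + 1) * fps_nth (polylog_fps k oo (1 - fps_exp (-1))) (l + 1)"
  unfolding poly_bernoulli_def sum_binomial_fps_exp_minus fps_deriv_polylog_compose[symmetric]
  by (simp add: algebra_simps)

lemma sum_mixed_bernoulli:
  "(\<Sum>m=0..n. of_nat ((n + 1) choose m) * (-1) ^ (n - m) * mixed_bernoulli r k m) =
   fact (n + 1) *
     fps_nth (bernoulli_order_fps r * (polylog_fps k oo (1 - fps_exp (-1)))) (n + 1)"
proof -
  define S where "S = bernoulli_order_fps r * poly_bernoulli_fps k"
  \<comment> \<open>The exponent is \<open>n + 1 - m\<close> to match the binomial convolution of
    index \<open>n + 1\<close>; this costs one overall sign.\<close>
  let ?f = "\<lambda>m. (-1) ^ (n + 1 - m) * of_nat ((n + 1) choose m) * (fact m * fps_nth S m)"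
  have "(\<Sum>m=0..n. of_nat ((n + 1) choose m) * (-1) ^ (n - m) * mixed_bernoulli r k m) =
        - (\<Sum>m=0..n. ?f m)"
    unfolding sum_negf[symmetric]
    by (rule sum.cong) (auto simp: mixed_bernoulli_def S_def Suc_diff_le)
  \<comment> \<open>The missing term \<open>m = n + 1\<close> is added and subtracted; it accounts
    for the 1 in \<open>1 - fps_exp (-1)\<close>.\<close>
  also have "\<dots> = fact (n + 1) * fps_nth S (n + 1) - (\<Sum>m=0..n+1. ?f m)"
    by simp
  also have "\<dots> = fact (n + 1) * fps_nth (S * (1 - fps_exp (-1))) (n + 1)"
    unfolding sum_binomial_fps_exp_minus by (simp add: right_diff_distrib)
  also have "S * (1 - fps_exp (-1)) =
             bernoulli_order_fps r * (polylog_fps k oo (1 - fps_exp (-1)))"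
    by (simp only: S_def mult.assoc poly_bernoulli_fps_mult)
  finally show ?thesis .
qed

theorem theorem5:
  fixes n :: nat and r k :: int
  shows "(\<Sum>m=0..n. of_nat ((n + 1) choose m) * (-1) ^ (n - m) * mixed_bernoulli r k m) =
         (\<Sum>l=0..n. \<Sum>m=0..l. (-1) ^ (l - m) * of_nat (l choose m) * of_nat ((n + 1) choose (l + 1))
            * poly_bernoulli (k - 1) m * bernoulli_order r (n - l))"
proof -
  define L where "L = polylog_fps k oo (1 - fps_exp (-1))"
  have L0: "fps_nth L 0 = 0"
    by (simp add: L_def polylog_fps_def)
  \<comment> \<open>Writing \<open>n - l\<close> as \<open>Suc n - Suc l\<close> prepares the index
    shift to a Cauchy product of index \<open>n + 1\<close>.\<close>
  have "(\<Sum>m=0..l. (-1) ^ (l - m) * of_nat (l choose m) * of_nat ((n + 1) choose (l + 1))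
            * poly_bernoulli (k - 1) m * bernoulli_order r (n - l)) =
        fact (n + 1) * (fps_nth L (Suc l) * fps_nth (bernoulli_order_fps r) (Suc n - Suc l))"
    if "l \<le> n" for l
  proof -
    have "(\<Sum>m=0..l. (-1) ^ (l - m) * of_nat (l choose m) * of_nat ((n + 1) choose (l + 1))
            * poly_bernoulli (k - 1) m * bernoulli_order r (n - l)) =
          of_nat ((n + 1) choose (l + 1)) * bernoulli_order r (n - l) *
          (\<Sum>m=0..l. (-1) ^ (l - m) * of_nat (l choose m) * poly_bernoulli (k - 1) m)"
      by (simp add: sum_distrib_left mult_ac)
    also have "\<dots> = (of_nat ((n + 1) choose (l + 1)) * fact (l + 1) * fact (n - l)) *
                    (fps_nth L (Suc l) * fps_nth (bernoulli_order_fps r) (n - l))"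
      unfolding sum_poly_bernoulli L_def[symmetric] bernoulli_order_def by simp
    also have "of_nat ((n + 1) choose (l + 1)) * fact (l + 1) * fact (n - l) =
               (fact (n + 1) :: complex)"
      using that binomial_fact[of "l + 1" "n + 1", where ?'a = complex]
      by (simp del: fact_Suc binomial_Suc_Suc)
    finally show ?thesis by simp
  qed
  then have "(\<Sum>l=0..n. \<Sum>m=0..l. (-1) ^ (l - m) * of_nat (l choose m) * of_nat ((n + 1) choose (l + 1))
            * poly_bernoulli (k - 1) m * bernoulli_order r (n - l)) =
        fact (n + 1) *
          (\<Sum>l=0..n. fps_nth L (Suc l) * fps_nth (bernoulli_order_fps r) (Suc n - Suc l))"
    by (simp add: sum_distrib_left)
  \<comment> \<open>The shifted sum gains only the term \<open>l = 0\<close>, which vanishes by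
    \<open>L0\<close>.\<close>
  also have "(\<Sum>l=0..n. fps_nth L (Suc l) * fps_nth (bernoulli_order_fps r) (Suc n - Suc l)) =
             (\<Sum>l=0..Suc n. fps_nth L l * fps_nth (bernoulli_order_fps r) (Suc n - l))"
    by (simp only: sum.atLeast0_atMost_Suc_shift) (simp add: L0)
  also have "\<dots> = fps_nth (bernoulli_order_fps r * L) (n + 1)"
    by (simp add: fps_mult_nth mult.commute[of _ L])
  finally show ?thesis
    unfolding sum_mixed_bernoulli L_def by (rule sym)
qed

end
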